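(* Let $I(\boldsymbol{B},\boldsymbol{r})$ be a diagonal blockwise determinantal ideal with $\boldsymbol{B}=(B_1,\dots,B_k)$, $\boldsymbol{r}=(r_1,\dots,r_k)$, and suppose that its generating set $\mathcal{G}$ (the set of all $r_i$-minors in $B_i$ for all $i$) is a minimal Gröbner basis with respect to a diagonal term order. If for each $\boldsymbol{m}\in\mathcal{G}$, $\boldsymbol{m}\cap\tilde B$ consists of consecutive full rows or columns of the submatrix of $\boldsymbol{m}$ for every block $\tilde B\in\boldsymbol{B}\setminus\boldsymbol{B}_{\boldsymbol{m}}$, where $\boldsymbol{B}_{\boldsymbol{m}}=\{B_i: r_i=\deg(\boldsymbol{m})\}$, then $\mathcal{G}$ is the reduced Gröbner basis of $I(\boldsymbol{B},\boldsymbol{r})$.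
   Context: Let $K$ be a field and $X=(x_{ij})$ a generic $m\times n$ matrix ($m\le n$) of distinct variables; $K[\boldsymbol{x}]$ is the polynomial ring in all $mn$ variables. A subset of $X$ means a set of entries. An $r$-minor of $X$ is the determinant of an $r\times r$ submatrix (arbitrary row and column index sets of size $r$), regarded as a polynomial; it is a minor in a subset $B$ if all entries of the submatrix belong to $B$. A term order is diagonal if the leading term of every minor of $X$ is the product of the diagonal entries of the corresponding submatrix. A non-empty subset $B$ of $X$ is diagonal if whenever $x_{pq},x_{\tilde p\tilde q}\in B$ with $p\le\tilde p$, $q\le\tilde q$, all $x_{ij}$ with $p\le i\le\tilde p$, $q\le j\le\tilde q$ belong to $B$. For a sequence $\boldsymbol{B}=(B_1,\dots,B_k)$ of non-empty subsets of $X$ (blocks) and a sequence $\boldsymbol{r}=(r_1,\dots,r_k)$ of positive integers, the blockwise determinantal ideal $I(\boldsymbol{B},\boldsymbol{r})\subseteq K[\boldsymbol{x}]$ is generated by all $r_i$-minors in $B_i$ for all $i$; it is diagonal when all blocks are diagonal. Blocks are understood together with their associated minor sizes, so $\boldsymbol{B}\setminus\boldsymbol{B}_{\boldsymbol{m}}$ consists of the $B_j$ with $r_j\ne\deg(\boldsymbol{m})$. For a minor $\boldsymbol{m}$ and a block $\tilde B$, $\boldsymbol{m}\cap\tilde B$ is the set of entries of the submatrix of $\boldsymbol{m}$ lying in $\tilde B$. It consists of consecutive full rows (columns) if it is the union of complete rows (columns) of the submatrix of $\boldsymbol{m}$ that are consecutive in that submatrix (possibly none, when the intersection is empty). A Gröbner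 basis $\mathcal{G}$ is minimal if for each $G\in\mathcal{G}$ the leading term of $G$ is not divisible by the leading term of any other element of $\mathcal{G}$ and the leading coefficient of $G$ is $\pm1$. It is reduced if for each $G\in\mathcal{G}$ no term of $G$ is divisible by the leading term of an element of $\mathcal{G}\setminus\{G\}$, and the leading coefficient of $G$ is $\pm1$ (unique up to signs). *)

theory Defs
  imports "HOL-Library.Cardinality" "HOL-Library.Poly_Mapping" "Jordan_Normal_Form.Determinant"
begin

section \<open>Polynomials in the entries of a generic matrix\<close>

text \<open>
  The rows and columns of the generic matrix are indexed by two finite linearly ordered types
  \<open>'m\<close> and \<open>'n\<close>, so that the variables of \<open>K[x]\<close> are exactly the \<open>CARD('m) * CARD('n)\<close> pairs
  \<open>(i, j)\<close>. A monomial is an exponent vector; multiplication of monomials is written \<open>+\<close>.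
\<close>

type_synonym ('m, 'n) mon = "('m \<times> 'n) \<Rightarrow>\<^sub>0 nat"
type_synonym ('m, 'n, 'k) mpol = "('m, 'n) mon \<Rightarrow>\<^sub>0 'k"

definition var :: "'m \<Rightarrow> 'n \<Rightarrow> ('m, 'n, 'k::field) mpol"
  where "var i j = Poly_Mapping.single (Poly_Mapping.single (i, j) 1) 1"

definition mon_deg :: "('m::finite, 'n::finite) mon \<Rightarrow> nat"
  where "mon_deg t = (\<Sum>v\<in>UNIV. Poly_Mapping.lookup t v)"

definition total_deg :: "('m::finite, 'n::finite, 'k::field) mpol \<Rightarrow> nat"
  where "total_deg p = Max (insert 0 (mon_deg ` Poly_Mapping.keys p))"

definition mon_dvd :: "('m, 'n) mon \<Rightarrow> ('m, 'n) mon \<Rightarrow> bool"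
  where "mon_dvd s t \<longleftrightarrow> (\<exists>u. t = s + u)"

definition ideal_gen :: "('m, 'n, 'k::field) mpol set \<Rightarrow> ('m, 'n, 'k) mpol set"
  where "ideal_gen S = Modules.module.span (*) S"

section \<open>Term orders and Groebner bases\<close>

text \<open>Since there are finitely many variables, a term order is automatically a well-order.\<close>

definition term_order :: "(('m::finite, 'n::finite) mon \<Rightarrow> ('m, 'n) mon \<Rightarrow> bool) \<Rightarrow> bool"
  where "term_order tle \<longleftrightarrow>
    class.linorder tle (\<lambda>s t. tle s t \<and> s \<noteq> t) \<and>
    (\<forall>t. tle 0 t) \<and>
    (\<forall>s t u. tle s t \<longrightarrow> tle (s + u) (t + u))"

text \<open>The leading monomial and leading coefficient are only meaningful for nonzero polynomials.\<close>

definition lead_mon ::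
    "(('m, 'n) mon \<Rightarrow> ('m, 'n) mon \<Rightarrow> bool) \<Rightarrow> ('m, 'n, 'k::field) mpol \<Rightarrow> ('m, 'n) mon"
  where "lead_mon tle p =
    (THE t. t \<in> Poly_Mapping.keys p \<and> (\<forall>s\<in>Poly_Mapping.keys p. tle s t))"

definition lead_cf ::
    "(('m, 'n) mon \<Rightarrow> ('m, 'n) mon \<Rightarrow> bool) \<Rightarrow> ('m, 'n, 'k::field) mpol \<Rightarrow> 'k"
  where "lead_cf tle p = Poly_Mapping.lookup p (lead_mon tle p)"

definition lead_ideal ::
    "(('m, 'n) mon \<Rightarrow> ('m, 'n) mon \<Rightarrow> bool) \<Rightarrow> ('m, 'n, 'k::field) mpol set \<Rightarrow> ('m, 'n, 'k) mpol set"
  where "lead_ideal tle S =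
    ideal_gen ((\<lambda>f. Poly_Mapping.single (lead_mon tle f) 1) ` (S - {0}))"

definition groebner_basis ::
    "(('m, 'n) mon \<Rightarrow> ('m, 'n) mon \<Rightarrow> bool) \<Rightarrow>
     ('m, 'n, 'k::field) mpol set \<Rightarrow> ('m, 'n, 'k) mpol set \<Rightarrow> bool"
  where "groebner_basis tle G I \<longleftrightarrow>
    finite G \<and> G \<subseteq> I \<and> lead_ideal tle G = lead_ideal tle I"

text \<open>In the next two definitions the condition on leading coefficients excludes \<open>0 \<in> G\<close>.\<close>

definition minimal_groebner_basis ::
    "(('m, 'n) mon \<Rightarrow> ('m, 'n) mon \<Rightarrow> bool) \<Rightarrow>
     ('m, 'n, 'k::field) mpol set \<Rightarrow> ('m, 'n, 'k) mpol set \<Rightarrow> bool"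
  where "minimal_groebner_basis tle G I \<longleftrightarrow>
    groebner_basis tle G I \<and>
    (\<forall>g\<in>G. (\<forall>h\<in>G - {g}. \<not> mon_dvd (lead_mon tle h) (lead_mon tle g)) \<and>
            lead_cf tle g \<in> {1, -1})"

definition reduced_groebner_basis ::
    "(('m, 'n) mon \<Rightarrow> ('m, 'n) mon \<Rightarrow> bool) \<Rightarrow>
     ('m, 'n, 'k::field) mpol set \<Rightarrow> ('m, 'n, 'k) mpol set \<Rightarrow> bool"
  where "reduced_groebner_basis tle G I \<longleftrightarrow>
    groebner_basis tle G I \<and>
    (\<forall>g\<in>G. (\<forall>t\<in>Poly_Mapping.keys g. \<forall>h\<in>G - {g}. \<not> mon_dvd (lead_mon tle h) t) \<and>
            lead_cf tle g \<in> {1, -1})"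

section \<open>Minors\<close>

text \<open>
  A square submatrix is given by its set \<open>I\<close> of rows and its set \<open>J\<close> of columns; its entries
  are the elements of \<open>I \<times> J\<close>.
\<close>

definition square_sub :: "'m set \<Rightarrow> 'n set \<Rightarrow> bool"
  where "square_sub I J \<longleftrightarrow> I \<noteq> {} \<and> J \<noteq> {} \<and> card I = card J"

definition minor ::
    "'m::{finite,linorder} set \<Rightarrow> 'n::{finite,linorder} set \<Rightarrow> ('m, 'n, 'k::field) mpol"
  where "minor I J =
    det (mat (card I) (card I)
      (\<lambda>(a, b). var (sorted_list_of_set I ! a) (sorted_list_of_set J ! b)))"

definition diag_mon ::
    "'m::{finite,linorder} set \<Rightarrow> 'n::{finite,linorder} set \<Rightarrow> ('m, 'n) mon"
  where "diag_mon I J =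
    (\<Sum>a<card I. Poly_Mapping.single (sorted_list_of_set I ! a, sorted_list_of_set J ! a) 1)"

text \<open>The argument of type \<open>'k itself\<close> only fixes the coefficient field.\<close>

definition diagonal_term_order ::
    "'k::field itself \<Rightarrow>
     (('m::{finite,linorder}, 'n::{finite,linorder}) mon \<Rightarrow> ('m, 'n) mon \<Rightarrow> bool) \<Rightarrow> bool"
  where "diagonal_term_order K tle \<longleftrightarrow>
    term_order tle \<and>
    (\<forall>I J. square_sub I J \<longrightarrow>
       lead_mon tle (minor I J :: ('m, 'n, 'k) mpol) = diag_mon I J)"

section \<open>Blockwise determinantal ideals\<close>

definition diagonal_block :: "('m::linorder \<times> 'n::linorder) set \<Rightarrow> bool"
  where "diagonal_block B \<longleftrightarrow> B \<noteq> {} \<and>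
    (\<forall>p q p' q'. (p, q) \<in> B \<and> (p', q') \<in> B \<and> p \<le> p' \<and> q \<le> q' \<longrightarrow>
       {p..p'} \<times> {q..q'} \<subseteq> B)"

definition minors_in ::
    "('m::{finite,linorder} \<times> 'n::{finite,linorder}) set \<Rightarrow> nat \<Rightarrow> ('m, 'n, 'k::field) mpol set"
  where "minors_in B r = {minor I J | I J. card I = r \<and> card J = r \<and> I \<times> J \<subseteq> B}"

definition block_minors ::
    "('m::{finite,linorder} \<times> 'n::{finite,linorder}) set list \<Rightarrow> nat list \<Rightarrow>
     ('m, 'n, 'k::field) mpol set"
  where "block_minors Bs rs = (\<Union>i<length Bs. minors_in (Bs ! i) (rs ! i))"

definition blockwise_det_ideal ::
    "('m::{finite,linorder} \<times> 'n::{finite,linorder}) set list \<Rightarrow> nat list \<Rightarrow>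
     ('m, 'n, 'k::field) mpol set"
  where "blockwise_det_ideal Bs rs = ideal_gen (block_minors Bs rs)"

text \<open>\<open>I'\<close> is a (possibly empty) run of consecutive elements of \<open>I\<close>.\<close>

definition consecutive_in :: "'a::linorder set \<Rightarrow> 'a set \<Rightarrow> bool"
  where "consecutive_in I I' \<longleftrightarrow> I' \<subseteq> I \<and> (\<forall>a\<in>I'. \<forall>c\<in>I'. I \<inter> {a..c} \<subseteq> I')"

definition consecutive_full_rows ::
    "'m::linorder set \<Rightarrow> 'n set \<Rightarrow> ('m \<times> 'n) set \<Rightarrow> bool"
  where "consecutive_full_rows I J S \<longleftrightarrow> (\<exists>I'. consecutive_in I I' \<and> S = I' \<times> J)"

definition consecutive_full_cols ::
    "'m set \<Rightarrow> 'n::linorder set \<Rightarrow> ('m \<times> 'n) set \<Rightarrow> bool"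
  where "consecutive_full_cols I J S \<longleftrightarrow> (\<exists>J'. consecutive_in J J' \<and> S = I \<times> J')"

end

theory Submission
  imports Defs
begin

text \<open>
  Suppose the leading term of some \<open>h \<in> G\<close> divides a term \<open>t\<close> of \<open>g \<in> G\<close>, where \<open>g\<close> is the
  minor on \<open>I \<times> J\<close> and \<open>h \<noteq> g\<close> the one on \<open>I' \<times> J'\<close>. The term \<open>t\<close> uses every row of \<open>I\<close> and every
  column of \<open>J\<close> exactly once, and the leading term of \<open>h\<close> is the diagonal of \<open>I' \<times> J'\<close>. Hence
  \<open>I' \<subseteq> I\<close> and \<open>J' \<subseteq> J\<close>, that is, the submatrix of \<open>h\<close> lies inside that of \<open>g\<close>
  (\<open>diag_mon_dvd_minor_term\<close>). If both have the same size, then \<open>h = g\<close>.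

  Otherwise the block \<open>B\<close> from which \<open>h\<close> comes meets \<open>I \<times> J\<close> in full rows or full columns. As it
  contains \<open>I' \<times> J'\<close>, it contains all of \<open>I' \<times> J\<close> or all of \<open>I \<times> J'\<close>. There is then enough room to
  move the submatrix of \<open>h\<close> onto the diagonal of \<open>I \<times> J\<close> without leaving \<open>B\<close>: keep the rows \<open>I'\<close>
  and replace \<open>J'\<close> by the columns in which the diagonal meets these rows, or the other way
  round. The resulting minor belongs to \<open>G\<close>, has the size of \<open>h\<close>, and its diagonal divides the
  diagonal of \<open>I \<times> J\<close> (\<open>diag_mon_subset_dvd\<close>). This is a divisibility between two leading terms of \<open>G\<close>,
  which minimality forbids.
\<close>

section \<open>Transversal monomials\<close>

text \<open>
  All terms of a minor, including its diagonal, have this form with \<open>f\<close> a bijection from the rows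
  to the columns.
\<close>

definition transversal_mon :: "'m set \<Rightarrow> ('m \<Rightarrow> 'n) \<Rightarrow> ('m, 'n) mon"
  where "transversal_mon I f = (\<Sum>i\<in>I. Poly_Mapping.single (i, f i) 1)"

lemma lookup_transversal_mon:
  assumes "finite I"
  shows "Poly_Mapping.lookup (transversal_mon I f) (i, j) = of_bool (i \<in> I \<and> j = f i)"
proof -
  have "Poly_Mapping.lookup (transversal_mon I f) (i, j)
      = (\<Sum>a\<in>I. if a = i then of_bool (j = f i) else 0)"
    unfolding transversal_mon_def lookup_sum
    by (intro sum.cong) (auto simp: lookup_single when_def)
  then show ?thesis
    using assms by simp
qed

lemma mon_deg_transversal_mon:
  fixes I :: "'m::finite set" and f :: "'m \<Rightarrow> 'n::finite"
  shows "mon_deg (transversal_mon I f) = card I"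
proof -
  have "mon_deg (transversal_mon I f)
      = (\<Sum>v\<in>UNIV \<times> UNIV. case v of (i, j) \<Rightarrow> of_bool (i \<in> I \<and> j = f i))"
    unfolding mon_deg_def UNIV_Times_UNIV
    by (intro sum.cong) (auto simp: lookup_transversal_mon)
  also have "\<dots> = (\<Sum>i\<in>UNIV. \<Sum>j\<in>UNIV. of_bool (i \<in> I \<and> j = f i))"
    by (rule sum.cartesian_product[symmetric])
  also have "\<dots> = (\<Sum>i\<in>UNIV. of_bool (i \<in> I))"
    by (intro sum.cong refl) (simp add: of_bool_conj)
  also have "\<dots> = card I"
    by simp
  finally show ?thesis .
qed

lemma transversal_mon_dvdD:
  assumes "finite I" "finite I'"
    and "mon_dvd (transversal_mon I' f') (transversal_mon I f)"
  shows "I' \<subseteq> I" and "f' ` I' \<subseteq> f ` I"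
proof -
  obtain u where u: "transversal_mon I f = transversal_mon I' f' + u"
    using assms(3) by (auto simp: mon_dvd_def)
  have "i \<in> I \<and> f' i = f i" if "i \<in> I'" for i
    using arg_cong[OF u, of "\<lambda>t. Poly_Mapping.lookup t (i, f' i)"] that assms(1,2)
    by (cases "i \<in> I \<and> f' i = f i") (auto simp: lookup_add lookup_transversal_mon)
  then show "I' \<subseteq> I" and "f' ` I' \<subseteq> f ` I"
    by auto
qed

lemma transversal_mon_subset_dvd:
  assumes "finite I" and "I' \<subseteq> I"
  shows "mon_dvd (transversal_mon I' f) (transversal_mon I f)"
  unfolding mon_dvd_def transversal_mon_def
  using sum.subset_diff[OF assms(2,1)] by (metis add.commute)

lemma bij_betw_nth_sorted_list_of_set:
  fixes I :: "'a::linorder set"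
  assumes "finite I"
  shows "bij_betw ((!) (sorted_list_of_set I)) {..<card I} I"
    and "strict_mono_on {..<card I} ((!) (sorted_list_of_set I))"
proof -
  show "bij_betw ((!) (sorted_list_of_set I)) {..<card I} I"
    using assms by (intro bij_betw_nth) auto
  show "strict_mono_on {..<card I} ((!) (sorted_list_of_set I))"
    using assms by (intro strict_mono_onI) (simp add: sorted_wrt_nth_less[OF strict_sorted_list_of_set])
qed

lemma sum_sorted_list_of_set_nth:
  fixes I :: "'a::linorder set"
  assumes "finite I"
  shows "(\<Sum>a<card I. g (sorted_list_of_set I ! a)) = (\<Sum>i\<in>I. g i)"
  using bij_betw_nth_sorted_list_of_set(1)[OF assms] by (rule sum.reindex_bij_betw)

section \<open>Diagonals of submatrices\<close>

lemma diag_mon_strict_mono: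
  fixes f :: "'m::{finite,linorder} \<Rightarrow> 'n::{finite,linorder}"
  assumes "strict_mono_on I f"
  shows "diag_mon I (f ` I) = transversal_mon I f"
proof -
  have inj: "inj_on f I"
    using assms by (rule strict_mono_on_imp_inj_on)
  have "sorted_list_of_set (f ` I) = map f (sorted_list_of_set I)"
  proof (rule sorted_distinct_set_unique)
    show "sorted (map f (sorted_list_of_set I))"
      unfolding sorted_map
      by (rule sorted_wrt_mono_rel[OF _ sorted_sorted_list_of_set])
        (simp add: strict_mono_on_leD[OF assms])
  qed (use inj in \<open>auto simp: distinct_map\<close>)
  then show ?thesis
    unfolding diag_mon_def transversal_mon_def
    using sum_sorted_list_of_set_nth[of I "\<lambda>i. Poly_Mapping.single (i, f i) (1::nat)"]
    by (simp add: card_image[OF inj])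
qed

lemma ex_strict_mono_on_image:
  fixes I :: "'m::linorder set" and J :: "'n::linorder set"
  assumes "finite I" "finite J" "card I = card J"
  obtains d where "strict_mono_on I d" and "d ` I = J"
proof -
  let ?h = "(!) (sorted_list_of_set I)" and ?k = "(!) (sorted_list_of_set J)"
  have h: "bij_betw ?h {..<card I} I" "strict_mono_on {..<card I} ?h"
    using bij_betw_nth_sorted_list_of_set[OF assms(1)] .
  have k: "bij_betw ?k {..<card I} J" "strict_mono_on {..<card I} ?k"
    using bij_betw_nth_sorted_list_of_set[OF assms(2)] assms(3) by simp_all
  define d where "d = ?k \<circ> inv_into {..<card I} ?h"
  have "strict_mono_on I d"
  proof (rule strict_mono_onI)
    fix i i' assume *: "i \<in> I" "i' \<in> I" "i < i'"
    then obtain a a' where a: "a < card I" "a' < card I" "i = ?h a" "i' = ?h a'"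
      using h(1) unfolding bij_betw_def by blast
    then have "a < a'"
      using * h(2) by (metis lessThan_iff strict_mono_on_less)
    then show "d i < d i'"
      using a h(1) k(2)
      by (simp add: d_def bij_betw_inv_into_left strict_mono_onD)
  qed
  moreover have "d ` I = J"
    using bij_betw_trans[OF bij_betw_inv_into[OF h(1)] k(1)]
    by (simp add: d_def bij_betw_def)
  ultimately show thesis
    using that by blast
qed

lemma diag_mon_transversal:
  fixes I :: "'m::{finite,linorder} set" and J :: "'n::{finite,linorder} set"
  assumes "card I = card J"
  obtains d where "strict_mono_on I d" "d ` I = J" "diag_mon I J = transversal_mon I d"
proof -
  obtain d where d: "strict_mono_on I d" "d ` I = J"
    using ex_strict_mono_on_image[of I J] assms by auto
  show thesis
    using that[OF d] diag_mon_strict_mono[OF d(1)] d(2) by simp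
qed

lemma mon_deg_diag_mon:
  fixes I :: "'m::{finite,linorder} set" and J :: "'n::{finite,linorder} set"
  assumes "card I = card J"
  shows "mon_deg (diag_mon I J) = card I"
  using diag_mon_transversal[OF assms] by (metis mon_deg_transversal_mon)

text \<open>
  Selecting some rows together with the columns that a diagonal attaches to them yields a
  submatrix whose diagonal is part of the original one.
\<close>

lemma diag_mon_subset_dvd:
  fixes d :: "'m::{finite,linorder} \<Rightarrow> 'n::{finite,linorder}"
  assumes "strict_mono_on I d" and "I' \<subseteq> I"
  shows "mon_dvd (diag_mon I' (d ` I')) (diag_mon I (d ` I))"
  using assms by (simp add: diag_mon_strict_mono monotone_on_subset transversal_mon_subset_dvd)

section \<open>Terms of minors\<close>

lemma prod_single_one:
  "(\<Prod>a\<in>A. Poly_Mapping.single (t a) 1)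
    = (Poly_Mapping.single (\<Sum>a\<in>A. t a) (1::'k::comm_ring_1) :: 'b::comm_monoid_add \<Rightarrow>\<^sub>0 'k)"
  by (induction A rule: infinite_finite_induct) (simp_all add: mult_single)

lemma minor_term_transversal:
  fixes I :: "'m::{finite,linorder} set" and J :: "'n::{finite,linorder} set"
  assumes card: "card I = card J"
    and t: "t \<in> Poly_Mapping.keys (minor I J :: ('m, 'n, 'k::field) mpol)"
  obtains f where "f ` I = J" and "t = transversal_mon I f"
proof -
  let ?n = "card I" and ?xs = "sorted_list_of_set I" and ?ys = "sorted_list_of_set J"
  let ?s = "\<lambda>p. \<Sum>a<?n. Poly_Mapping.single (?xs ! a, ?ys ! p a) (1::nat)"
  let ?T = "\<lambda>p. signof p * Poly_Mapping.single (?s p) 1 :: ('m, 'n, 'k) mpol"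
  have "(minor I J :: ('m, 'n, 'k) mpol) = (\<Sum>p | p permutes {0..<?n}. ?T p)"
    unfolding minor_def det_def var_def
    by (auto intro!: sum.cong simp: permutes_in_image prod_single_one[symmetric] atLeast0LessThan)
  with t have "t \<in> (\<Union>p\<in>{p. p permutes {0..<?n}}. Poly_Mapping.keys (?T p))"
    using keys_sum by fastforce
  then obtain p where p: "p permutes {..<?n}" and "t \<in> Poly_Mapping.keys (?T p)"
    by (auto simp: atLeast0LessThan)
  then have tp: "t = ?s p"
    by (auto simp: sign_def split: if_splits)
  have xs: "bij_betw ((!) ?xs) {..<?n} I" and ys: "bij_betw ((!) ?ys) {..<?n} J"
    using bij_betw_nth_sorted_list_of_set(1)[of I] bij_betw_nth_sorted_list_of_set(1)[of J] card
    by simp_all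
  define f where "f = (!) ?ys \<circ> p \<circ> inv_into {..<?n} ((!) ?xs)"
  have "bij_betw f I J"
    unfolding f_def
    using bij_betw_trans[OF bij_betw_trans[OF bij_betw_inv_into[OF xs] permutes_imp_bij[OF p]] ys]
    by (simp add: comp_assoc)
  moreover have "f (?xs ! a) = ?ys ! p a" if "a < ?n" for a
    using that xs by (simp add: f_def bij_betw_inv_into_left)
  then have "t = transversal_mon I f"
    unfolding tp transversal_mon_def
    by (subst sum_sorted_list_of_set_nth[symmetric]) (auto intro!: sum.cong)
  ultimately show thesis
    using that by (auto simp: bij_betw_def)
qed

lemma total_deg_minor:
  fixes I :: "'m::{finite,linorder} set" and J :: "'n::{finite,linorder} set"
  assumes "card I = card J" and "(minor I J :: ('m, 'n, 'k::field) mpol) \<noteq> 0"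
  shows "total_deg (minor I J :: ('m, 'n, 'k) mpol) = card I"
proof -
  let ?g = "minor I J :: ('m, 'n, 'k) mpol"
  have "mon_deg t = card I" if "t \<in> Poly_Mapping.keys ?g" for t
    using minor_term_transversal[OF assms(1) that] by (metis mon_deg_transversal_mon)
  then have "mon_deg ` Poly_Mapping.keys ?g = (\<lambda>_. card I) ` Poly_Mapping.keys ?g"
    by (intro image_cong refl)
  also have "\<dots> = {card I}"
    using assms(2) by (simp add: image_constant_conv)
  finally have "mon_deg ` Poly_Mapping.keys ?g = {card I}" .
  then show ?thesis
    by (simp add: total_deg_def)
qed

text \<open>
  A variable dividing a term of a minor lies in the submatrix, and a diagonal contains a variable
  from each of its own rows and columns.
\<close>

lemma diag_mon_dvd_minor_term:
  fixes I I' :: "'m::{finite,linorder} set" and J J' :: "'n::{finite,linorder} set"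
  assumes "card I = card J" and "card I' = card J'"
    and "t \<in> Poly_Mapping.keys (minor I J :: ('m, 'n, 'k::field) mpol)"
    and "mon_dvd (diag_mon I' J') t"
  shows "I' \<subseteq> I" and "J' \<subseteq> J"
proof -
  obtain f where f: "f ` I = J" "t = transversal_mon I f"
    using minor_term_transversal[OF assms(1,3)] .
  obtain d where d: "d ` I' = J'" "diag_mon I' J' = transversal_mon I' d"
    using diag_mon_transversal[OF assms(2)] .
  show "I' \<subseteq> I" and "J' \<subseteq> J"
    using transversal_mon_dvdD[of I I' d f] assms(4) f d by auto
qed

section \<open>Blocks meeting a submatrix in full rows or columns\<close>

text \<open>
  The minor on \<open>I' \<times> J'\<close> need not sit on the diagonal of \<open>I \<times> J\<close>; fullness of the rows (or columns)
  is what lets it slide there inside the block.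
\<close>

lemma full_lines_minor_on_diagonal:
  fixes I I' :: "'m::{finite,linorder} set" and J J' :: "'n::{finite,linorder} set"
  assumes card: "card I = card J" "card I' = card J'" "0 < card I'"
    and sub: "I' \<subseteq> I" "J' \<subseteq> J" "I' \<times> J' \<subseteq> B"
    and full: "consecutive_full_rows I J ((I \<times> J) \<inter> B) \<or> consecutive_full_cols I J ((I \<times> J) \<inter> B)"
  obtains I1 J1 where "card I1 = card I'" "card J1 = card I'" "I1 \<times> J1 \<subseteq> B"
    "mon_dvd (diag_mon I1 J1) (diag_mon I J)"
proof -
  obtain d where d: "strict_mono_on I d" "d ` I = J"
    using ex_strict_mono_on_image[of I J] card(1) by auto
  have inj: "inj_on d I"
    using d(1) by (rule strict_mono_on_imp_inj_on)
  have ne: "I' \<noteq> {}" "J' \<noteq> {}"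
    using card by auto
  have in_B: "I' \<times> J \<subseteq> B \<or> I \<times> J' \<subseteq> B"
    using full
  proof
    assume "consecutive_full_rows I J ((I \<times> J) \<inter> B)"
    then obtain R where R: "(I \<times> J) \<inter> B = R \<times> J"
      by (auto simp: consecutive_full_rows_def)
    have "I' \<times> J' \<subseteq> R \<times> J"
      using sub R by blast
    then have "I' \<subseteq> R"
      using ne by blast
    then show ?thesis
      using R by blast
  next
    assume "consecutive_full_cols I J ((I \<times> J) \<inter> B)"
    then obtain C where C: "(I \<times> J) \<inter> B = I \<times> C"
      by (auto simp: consecutive_full_cols_def)
    have "I' \<times> J' \<subseteq> I \<times> C"
      using sub C by blast
    then have "J' \<subseteq> C"
      using ne by blast
    then show ?thesis
      using C by blast
  qed
  obtain I1 where I1: "I1 \<subseteq> I" "card I1 = card I'" "I1 \<times> d ` I1 \<subseteq> B"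
  proof (cases "I' \<times> J \<subseteq> B")
    case True
    then show thesis
      using that[of I'] sub(1) d(2) by blast
  next
    case False
    \<comment> \<open>The rows in which the diagonal of \<open>I \<times> J\<close> meets the columns \<open>J'\<close>.\<close>
    let ?I1 = "I \<inter> d -` J'"
    have "d ` ?I1 = J'"
      using sub(2) d(2) by blast
    moreover have "card (d ` ?I1) = card ?I1"
      using inj by (intro card_image) (auto intro: inj_on_subset)
    ultimately show thesis
      using that[of ?I1] False in_B card(2) by auto
  qed
  have "card (d ` I1) = card I1"
    using inj I1(1) by (intro card_image) (auto intro: inj_on_subset)
  then show thesis
    using that[of I1 "d ` I1"] I1 diag_mon_subset_dvd[OF d(1) I1(1)] d(2) by simp
qed

section \<open>Reducedness\<close>

theorem corollary4p9:
  fixes Bs :: "('m::{finite,linorder} \<times> 'n::{finite,linorder}) set list"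
    and rs :: "nat list"
    and tle :: "('m, 'n) mon \<Rightarrow> ('m, 'n) mon \<Rightarrow> bool"
    and G :: "('m, 'n, 'k::field) mpol set"
  assumes "CARD('m) \<le> CARD('n)"
    and "length rs = length Bs"
    and "\<forall>i<length Bs. diagonal_block (Bs ! i)"
    and "\<forall>i<length Bs. 0 < rs ! i"
    and "diagonal_term_order TYPE('k) tle"
    and "G = block_minors Bs rs"
    and "minimal_groebner_basis tle G (blockwise_det_ideal Bs rs)"
    and "\<forall>I J. square_sub I J \<and> (minor I J :: ('m, 'n, 'k) mpol) \<in> G \<longrightarrow>
           (\<forall>i<length Bs. rs ! i \<noteq> total_deg (minor I J :: ('m, 'n, 'k) mpol) \<longrightarrow>
              consecutive_full_rows I J ((I \<times> J) \<inter> Bs ! i) \<or>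
              consecutive_full_cols I J ((I \<times> J) \<inter> Bs ! i))"
  shows "reduced_groebner_basis tle G (blockwise_det_ideal Bs rs)"
proof -
  have square: "square_sub I J" if "card I = rs ! i" "card J = rs ! i" "i < length Bs" for I J i
    using that assms(4) by (auto simp: square_sub_def)
  have lead: "lead_mon tle (minor I J :: ('m, 'n, 'k) mpol) = diag_mon I J"
    if "square_sub I J" for I J
    using that assms(5) by (simp add: diagonal_term_order_def)
  have in_G: "minor I J \<in> G" if "card I = rs ! i" "card J = rs ! i" "I \<times> J \<subseteq> Bs ! i" "i < length Bs"
    for I J i
    using that unfolding assms(6) block_minors_def minors_in_def by blast
  have gb: "groebner_basis tle G (blockwise_det_ideal Bs rs)"
    and minimal: "\<And>g h. g \<in> G \<Longrightarrow> h \<in> G \<Longrightarrow> h \<noteq> g \<Longrightarrow> \<not> mon_dvd (lead_mon tle h) (lead_mon tle g)"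
    and cf: "\<And>g. g \<in> G \<Longrightarrow> lead_cf tle g \<in> {1, -1}"
    using assms(7) by (auto simp: minimal_groebner_basis_def)
  have "\<not> mon_dvd (lead_mon tle h) t"
    if g: "g \<in> G" and h: "h \<in> G" and hg: "h \<noteq> g" and t: "t \<in> Poly_Mapping.keys g" for g h t
  proof
    assume dvd: "mon_dvd (lead_mon tle h) t"
    obtain i I J where i: "i < length Bs" and g_eq: "g = minor I J"
      and I: "card I = rs ! i" and J: "card J = rs ! i"
      using g unfolding assms(6) block_minors_def minors_in_def by blast
    obtain j I' J' where j: "j < length Bs" and h_eq: "h = minor I' J'"
      and I': "card I' = rs ! j" and J': "card J' = rs ! j" and B: "I' \<times> J' \<subseteq> Bs ! j"
      using h unfolding assms(6) block_minors_def minors_in_def by blast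
    have "mon_dvd (diag_mon I' J') t"
      using dvd lead[OF square[OF I' J' j]] by (simp add: h_eq)
    then have sub: "I' \<subseteq> I" "J' \<subseteq> J"
      using diag_mon_dvd_minor_term[of I J I' J' t] t I J I' J' by (auto simp: g_eq)
    show False
    proof (cases "rs ! j = rs ! i")
      case True
      then have "I' = I" "J' = J"
        using card_subset_eq[of I I'] card_subset_eq[of J J'] sub I J I' J' by auto
      then show False
        using hg by (simp add: g_eq h_eq)
    next
      case False
      have "g \<noteq> 0"
        using t by auto
      then have "total_deg g = rs ! i"
        using total_deg_minor[of I J] I J by (simp add: g_eq)
      then have full: "consecutive_full_rows I J ((I \<times> J) \<inter> Bs ! j) \<or>
          consecutive_full_cols I J ((I \<times> J) \<inter> Bs ! j)"
        using assms(8) square[OF I J i] g j False by (auto simp: g_eq)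
      have "0 < card I'"
        using I' j assms(4) by simp
      then obtain I1 J1 where I1: "card I1 = card I'" and J1: "card J1 = card I'"
        and B1: "I1 \<times> J1 \<subseteq> Bs ! j" and dvd1: "mon_dvd (diag_mon I1 J1) (diag_mon I J)"
        using full_lines_minor_on_diagonal[of I J I' J' "Bs ! j"] I J I' J' sub B full by metis
      let ?h1 = "minor I1 J1 :: ('m, 'n, 'k) mpol"
      have h1: "?h1 \<in> G" and lead1: "lead_mon tle ?h1 = diag_mon I1 J1"
        using in_G[OF _ _ B1 j] lead[OF square[of I1 j J1]] I1 J1 I' j by auto
      have lead_g: "lead_mon tle g = diag_mon I J"
        using lead[OF square[OF I J i]] by (simp add: g_eq)
      \<comment> \<open>Minimality only concerns distinct elements of \<open>G\<close>; the sizes tell these two apart.\<close>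
      have "mon_deg (lead_mon tle ?h1) \<noteq> mon_deg (lead_mon tle g)"
        using lead1 lead_g mon_deg_diag_mon[of I1 J1] mon_deg_diag_mon[of I J] I1 J1 I' I J False
        by simp
      then have "?h1 \<noteq> g"
        by auto
      then show False
        using minimal[OF g h1] dvd1 lead1 lead_g by simp
    qed
  qed
  then show ?thesis
    using gb cf by (auto simp: reduced_groebner_basis_def)
qed

end
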